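(* Let $\langle\mathrm{Proc},\Sigma,\to\rangle$ be a labelled transition system over a finite alphabet $\Sigma$. A property $L\subseteq\mathrm{Proc}$ is simulation-monitorable if and only if $L\in\tau_{\mathrm{sim}}$.
   Context: A labelled transition system is $\langle \mathrm{Proc},\Sigma,\to\rangle$ with $\to\subseteq \mathrm{Proc}\times\Sigma\times\mathrm{Proc}$. Finite loop-free processes: $\mathrm{Proc}_F$ is the set of terms generated by $q::=0\mid a.q\mid q+q$ with $a\in\Sigma$. Transitions: $q\xrightarrow{a}_F q'$ iff $q=a.q'$, or $q=q_1+q_2$ and ($q_1\xrightarrow{a}_F q'$ or $q_2\xrightarrow{a}_F q'$); $0$ has no transitions. $R\subseteq\mathrm{Proc}_F\times\mathrm{Proc}$ is a simulation if whenever $(q,p)\in R$ and $q\xrightarrow{a}_F q'$, there is $p'\in\mathrm{Proc}$ with $p\xrightarrow{a}p'$ and $(q',p')\in R$. Write $q\sqsubseteq_S p$ if $(q,p)\in R$ for some simulation $R$. For $q\in\mathrm{Proc}_F$, $O(q)=\{p\in\mathrm{Proc}\mid q\sqsubseteq_S p\}$; $\tau_{\mathrm{sim}}$ is the topology on $\mathrm{Proc}$ generated by the basis $\{O(q)\mid q\in\mathrm{Proc}_F\}$. A simulation monitor for $L$ is a function $m:\mathrm{Proc}_F\to\{\mathsf{yes},\mathsf{?}\}$ such that: (i) if $m(q)=\mathsf{yes}$ then $O(q)\subseteq L$; (ii) if $m(q)=\mathsf{yes}$ and $O(r)\subseteq O(q)$, for $r,q\in\mathrm{Proc}_F$, then $m(r)=\mathsf{yes}$.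 $L$ is simulation-monitorable if there is a simulation monitor $m$ for $L$ such that for every $p\in L$ there is $q\in\mathrm{Proc}_F$ with $p\in O(q)$ and $m(q)=\mathsf{yes}$. *)

theory Defs
  imports "HOL-Analysis.Analysis"
begin

definition lts :: "'p set \<Rightarrow> 'a set \<Rightarrow> ('p \<times> 'a \<times> 'p) set \<Rightarrow> bool" where
  "lts Proc \<Sigma> T \<longleftrightarrow> T \<subseteq> Proc \<times> \<Sigma> \<times> Proc"

datatype 'a fproc = Nil0 | Pre 'a "'a fproc" | Choice "'a fproc" "'a fproc"

text \<open>The alphabet is a set rather than a type, so the terms over it are carved out
  of the datatype.\<close>

inductive_set ProcF :: "'a set \<Rightarrow> 'a fproc set" for \<Sigma> :: "'a set" where
  "Nil0 \<in> ProcF \<Sigma>"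
| "a \<in> \<Sigma> \<Longrightarrow> q \<in> ProcF \<Sigma> \<Longrightarrow> Pre a q \<in> ProcF \<Sigma>"
| "q1 \<in> ProcF \<Sigma> \<Longrightarrow> q2 \<in> ProcF \<Sigma> \<Longrightarrow> Choice q1 q2 \<in> ProcF \<Sigma>"

inductive stepF :: "'a fproc \<Rightarrow> 'a \<Rightarrow> 'a fproc \<Rightarrow> bool" where
  "stepF (Pre a q) a q"
| "stepF q1 a q' \<Longrightarrow> stepF (Choice q1 q2) a q'"
| "stepF q2 a q' \<Longrightarrow> stepF (Choice q1 q2) a q'"

definition simulation ::
  "'p set \<Rightarrow> 'a set \<Rightarrow> ('p \<times> 'a \<times> 'p) set \<Rightarrow> ('a fproc \<times> 'p) set \<Rightarrow> bool" where
  "simulation Proc \<Sigma> T R \<longleftrightarrow>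
     R \<subseteq> ProcF \<Sigma> \<times> Proc \<and>
     (\<forall>q p a q'. (q, p) \<in> R \<and> stepF q a q' \<longrightarrow>
        (\<exists>p' \<in> Proc. (p, a, p') \<in> T \<and> (q', p') \<in> R))"

definition sim_le ::
  "'p set \<Rightarrow> 'a set \<Rightarrow> ('p \<times> 'a \<times> 'p) set \<Rightarrow> 'a fproc \<Rightarrow> 'p \<Rightarrow> bool" where
  "sim_le Proc \<Sigma> T q p \<longleftrightarrow> (\<exists>R. simulation Proc \<Sigma> T R \<and> (q, p) \<in> R)"

definition Obs ::
  "'p set \<Rightarrow> 'a set \<Rightarrow> ('p \<times> 'a \<times> 'p) set \<Rightarrow> 'a fproc \<Rightarrow> 'p set" where
  "Obs Proc \<Sigma> T q = {p \<in> Proc. sim_le Proc \<Sigma> T q p}"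

text \<open>\<open>topology_generated_by\<close> accepts an arbitrary subbasis. The family used here is a genuine
  basis of a topology on \<open>Proc\<close>: \<open>Obs\<close> maps \<open>Nil0\<close> to \<open>Proc\<close> and \<open>Choice\<close> to intersection.\<close>

definition tau_sim ::
  "'p set \<Rightarrow> 'a set \<Rightarrow> ('p \<times> 'a \<times> 'p) set \<Rightarrow> 'p topology" where
  "tau_sim Proc \<Sigma> T = topology_generated_by (Obs Proc \<Sigma> T ` ProcF \<Sigma>)"

datatype verdict = Yes | Unknown

text \<open>A monitor is a function on \<open>ProcF \<Sigma>\<close>; its values at other terms of the datatype are
  unconstrained and never inspected.\<close>

definition simulation_monitor ::
  "'p set \<Rightarrow> 'a set \<Rightarrow> ('p \<times> 'a \<times> 'p) set \<Rightarrow> 'p set \<Rightarrow> ('a fproc \<Rightarrow> verdict) \<Rightarrow> bool" where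
  "simulation_monitor Proc \<Sigma> T L m \<longleftrightarrow>
     (\<forall>q \<in> ProcF \<Sigma>. m q = Yes \<longrightarrow> Obs Proc \<Sigma> T q \<subseteq> L) \<and>
     (\<forall>q \<in> ProcF \<Sigma>. \<forall>r \<in> ProcF \<Sigma>.
        m q = Yes \<and> Obs Proc \<Sigma> T r \<subseteq> Obs Proc \<Sigma> T q \<longrightarrow> m r = Yes)"

definition simulation_monitorable ::
  "'p set \<Rightarrow> 'a set \<Rightarrow> ('p \<times> 'a \<times> 'p) set \<Rightarrow> 'p set \<Rightarrow> bool" where
  "simulation_monitorable Proc \<Sigma> T L \<longleftrightarrow>
     (\<exists>m. simulation_monitor Proc \<Sigma> T L m \<and>
       (\<forall>p \<in> L. \<exists>q \<in> ProcF \<Sigma>. p \<in> Obs Proc \<Sigma> T q \<and> m q = Yes))"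

end

(* Since Obs turns Choice into intersection, the sets Obs q form a basis, so L is open iff it is a
   union of such sets; the largest candidate monitor says Yes exactly when Obs q is contained in L. *)
theory Submission
  imports Defs
begin

inductive_cases stepF_ChoiceE: "stepF (Choice q1 q2) a q'"

text \<open>A simulation witnessing one pair also witnesses the pairs of successors it yields, so
  \<open>sim_le\<close> is itself a simulation. Later proofs can therefore unfold one step without
  handling a relation \<open>R\<close>.\<close>

lemma sim_le_dest:
  assumes "sim_le Proc \<Sigma> T q p"
  shows "q \<in> ProcF \<Sigma>" "p \<in> Proc"
    "\<And>a q'. stepF q a q' \<Longrightarrow> \<exists>p' \<in> Proc. (p, a, p') \<in> T \<and> sim_le Proc \<Sigma> T q' p'"
proof -
  obtain R where R: "simulation Proc \<Sigma> T R" "(q, p) \<in> R"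
    using assms by (auto simp: sim_le_def)
  then show "q \<in> ProcF \<Sigma>" "p \<in> Proc"
    by (auto simp: simulation_def)
  fix a q'
  assume "stepF q a q'"
  with R have "\<exists>p' \<in> Proc. (p, a, p') \<in> T \<and> (q', p') \<in> R"
    unfolding simulation_def by blast
  with R(1) show "\<exists>p' \<in> Proc. (p, a, p') \<in> T \<and> sim_le Proc \<Sigma> T q' p'"
    unfolding sim_le_def by blast
qed

text \<open>The converse of the unfolding, by coinduction: adding a single pair to
  \<open>sim_le\<close> keeps it a simulation. The new pair is answered by \<open>step\<close>, the
  old ones by \<open>sim_le_dest\<close>, and all successors land in \<open>sim_le\<close>.\<close>

lemma sim_leI:
  assumes "q \<in> ProcF \<Sigma>" "p \<in> Proc"
    and step: "\<And>a q'. stepF q a q' \<Longrightarrow> \<exists>p' \<in> Proc. (p, a, p') \<in> T \<and> sim_le Proc \<Sigma> T q' p'"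
  shows "sim_le Proc \<Sigma> T q p"
proof -
  let ?R = "insert (q, p) {(r, s). sim_le Proc \<Sigma> T r s}"
  have "?R \<subseteq> ProcF \<Sigma> \<times> Proc"
    using assms(1,2) by (auto dest: sim_le_dest(1,2))
  moreover have "\<exists>s' \<in> Proc. (s, a, s') \<in> T \<and> (r', s') \<in> ?R"
    if "(r, s) \<in> ?R" "stepF r a r'" for r s a r'
    using that step sim_le_dest(3) by fastforce
  ultimately have "simulation Proc \<Sigma> T ?R"
    unfolding simulation_def by blast
  then show ?thesis
    unfolding sim_le_def by blast
qed

text \<open>The moves of a choice are exactly those of its two summands, with the same targets.
  Comparing first steps is therefore enough, and no induction on terms is needed.\<close>

lemma sim_le_Choice_iff:
  assumes "q1 \<in> ProcF \<Sigma>" "q2 \<in> ProcF \<Sigma>"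
  shows "sim_le Proc \<Sigma> T (Choice q1 q2) p \<longleftrightarrow> sim_le Proc \<Sigma> T q1 p \<and> sim_le Proc \<Sigma> T q2 p"
proof
  assume *: "sim_le Proc \<Sigma> T (Choice q1 q2) p"
  show "sim_le Proc \<Sigma> T q1 p \<and> sim_le Proc \<Sigma> T q2 p"
    \<comment> \<open>Every move of a summand is a move of the choice, so \<open>*\<close> already
      provides the matching move of \<open>p\<close>.\<close>
    using sim_le_dest(2)[OF *] assms
    by (auto intro!: sim_leI intro: sim_le_dest(3)[OF *] stepF.intros)
next
  assume "sim_le Proc \<Sigma> T q1 p \<and> sim_le Proc \<Sigma> T q2 p"
  then show "sim_le Proc \<Sigma> T (Choice q1 q2) p"
    using assms
    by (auto intro!: sim_leI ProcF.intros elim!: stepF_ChoiceE dest: sim_le_dest(2) sim_le_dest(3))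
qed

lemma Obs_Choice:
  assumes "q1 \<in> ProcF \<Sigma>" "q2 \<in> ProcF \<Sigma>"
  shows "Obs Proc \<Sigma> T (Choice q1 q2) = Obs Proc \<Sigma> T q1 \<inter> Obs Proc \<Sigma> T q2"
  by (auto simp: Obs_def sim_le_Choice_iff assms)

text \<open>Replaces topology by a pointwise condition that has the shape of monitorability. The
  nontrivial point is that finite intersections of the generating sets need not be added.\<close>

lemma openin_tau_sim_iff:
  "openin (tau_sim Proc \<Sigma> T) L \<longleftrightarrow>
     (\<forall>p \<in> L. \<exists>q \<in> ProcF \<Sigma>. p \<in> Obs Proc \<Sigma> T q \<and> Obs Proc \<Sigma> T q \<subseteq> L)"
proof
  assume "openin (tau_sim Proc \<Sigma> T) L"
  then have "generate_topology_on (Obs Proc \<Sigma> T ` ProcF \<Sigma>) L"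
    by (simp add: tau_sim_def openin_topology_generated_by_iff)
  then show "\<forall>p \<in> L. \<exists>q \<in> ProcF \<Sigma>. p \<in> Obs Proc \<Sigma> T q \<and> Obs Proc \<Sigma> T q \<subseteq> L"
  \<comment> \<open>Induction on how \<open>L\<close> is generated; a generating set
    \<open>Obs Proc \<Sigma> T q\<close> has \<open>q\<close> itself as witness at each of its
    points.\<close>
  proof induction
    case (Int A B)
    show ?case
    proof
      fix p assume "p \<in> A \<inter> B"
      then obtain q r where
        "q \<in> ProcF \<Sigma>" "p \<in> Obs Proc \<Sigma> T q" "Obs Proc \<Sigma> T q \<subseteq> A"
        "r \<in> ProcF \<Sigma>" "p \<in> Obs Proc \<Sigma> T r" "Obs Proc \<Sigma> T r \<subseteq> B"
        using Int.IH by blast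
      then show "\<exists>q \<in> ProcF \<Sigma>. p \<in> Obs Proc \<Sigma> T q \<and> Obs Proc \<Sigma> T q \<subseteq> A \<inter> B"
        \<comment> \<open>The choice observes exactly what both \<open>q\<close> and
          \<open>r\<close> observe, so its set contains \<open>p\<close> and lies in both
          \<open>A\<close> and \<open>B\<close>.\<close>
        by (intro bexI[of _ "Choice q r"]) (auto simp: Obs_Choice intro: ProcF.intros)
    qed
  next
    case (UN K)
    then show ?case by (meson Union_iff Union_upper subset_trans)
  qed auto
next
  assume "\<forall>p \<in> L. \<exists>q \<in> ProcF \<Sigma>. p \<in> Obs Proc \<Sigma> T q \<and> Obs Proc \<Sigma> T q \<subseteq> L"
  moreover have "openin (tau_sim Proc \<Sigma> T) (Obs Proc \<Sigma> T q)" if "q \<in> ProcF \<Sigma>" for q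
    using that by (auto simp: tau_sim_def intro: topology_generated_by_Basis)
  ultimately show "openin (tau_sim Proc \<Sigma> T) L"
    \<comment> \<open>Openness is local: each point of \<open>L\<close> has an open neighbourhood
      \<open>Obs Proc \<Sigma> T q\<close> inside \<open>L\<close>.\<close>
    by (subst openin_subopen) blast
qed

theorem corollary5p15:
  fixes Proc :: "'p set" and \<Sigma> :: "'a set" and T :: "('p \<times> 'a \<times> 'p) set" and L :: "'p set"
  assumes "lts Proc \<Sigma> T"
    and "finite \<Sigma>"
    and "L \<subseteq> Proc"
  shows "simulation_monitorable Proc \<Sigma> T L \<longleftrightarrow> openin (tau_sim Proc \<Sigma> T) L"
proof
  assume "simulation_monitorable Proc \<Sigma> T L"
  then show "openin (tau_sim Proc \<Sigma> T) L"
    \<comment> \<open>The term accepted at \<open>p\<close> is the required witness, since soundness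
      of the monitor puts its observation set inside \<open>L\<close>.\<close>
    unfolding openin_tau_sim_iff simulation_monitorable_def simulation_monitor_def by meson
next
  assume L: "openin (tau_sim Proc \<Sigma> T) L"
  let ?m = "\<lambda>q. if Obs Proc \<Sigma> T q \<subseteq> L then Yes else Unknown"
  have "simulation_monitor Proc \<Sigma> T L ?m"
    \<comment> \<open>Soundness is built into \<open>?m\<close>; closure under smaller observation
      sets is transitivity of inclusion.\<close>
    by (auto simp: simulation_monitor_def split: if_splits)
  moreover have "\<forall>p \<in> L. \<exists>q \<in> ProcF \<Sigma>. p \<in> Obs Proc \<Sigma> T q \<and> ?m q = Yes"
    using L unfolding openin_tau_sim_iff by meson
  ultimately show "simulation_monitorable Proc \<Sigma> T L"
    unfolding simulation_monitorable_def by blast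
qed

end
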